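(* Let $f:\mathbb R^n\to[0,\infty)$, $n\ge 2$, be an $L_p$-nested function and $\varrho$ a probability density on $(0,\infty)$. The corresponding $L_p$-nested symmetric distribution (with radial density $\varrho$) has the density $$\rho(\boldsymbol x)=\frac{\varrho(f(\boldsymbol x))}{f(\boldsymbol x)^{n-1}\,\mathcal S_f(1)}=\frac{\varrho(f(\boldsymbol x))}{2^n f(\boldsymbol x)^{n-1}}\prod_{I\in\mathcal I}p_I^{\ell_I-1}\prod_{k=1}^{\ell_I-1}B\left[\frac{\sum_{i=1}^k n_{I,i}}{p_I},\frac{n_{I,k+1}}{p_I}\right]^{-1},$$ where $\mathcal I$ is the set of inner nodes (including the root) of the tree associated with $f$ and $B[a,b]=\Gamma[a]\Gamma[b]/\Gamma[a+b]$.
   Context: **$L_p$-nested functions.** An $L_p$-nested function $f:\mathbb R^n\to[0,\infty)$ is given by a finite rooted ordered tree whose $n$ leaves, read from left to right, correspond to the coordinates $x_1,\dots,x_n$; every inner node $I$ has $\ell_I\ge 2$ children, denoted $(I,1),\dots,(I,\ell_I)$, and carries an exponent $p_I>0$. Nodes are denoted by multi-indices describing the path from the root; the root is $\emptyset$. For a node $I$, $\boldsymbol x_I$ denotes the coordinates at leaves in the subtree under $I$, and $n_I$ is the number of those leaves ($n_I=1$ if $I$ is a leaf). Put $f_I(\boldsymbol x_I)=|x_i|$ if $I$ is the leaf of $x_i$, and $f_I(\boldsymbol x_I)=\left(\sum_{k=1}^{\ell_I} f_{I,k}(\boldsymbol x_{I,k})^{p_I}\right)^{1/p_I}$ if $I$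 is an inner node; $f=f_\emptyset$. **Surface.** $\mathcal S_f(R)=\frac{d}{dR}\mathcal V_f(R)$, where $\mathcal V_f(R)$ is the Lebesgue measure of $\{\boldsymbol x: f(\boldsymbol x)\le R\}$. **$L_p$-nested symmetric distribution.** A probability distribution on $\mathbb R^n$ is $L_p$-nested symmetric with respect to $f$ if it has a Lebesgue density that depends on $\boldsymbol x$ only through $f(\boldsymbol x)$. Its radial density is the density of the random variable $f(\boldsymbol X)$, where $\boldsymbol X$ has the given distribution; the $L_p$-nested symmetric distribution corresponding to $f$ and $\varrho$ is the one whose radial density is $\varrho$. *)

theory Defs
  imports "HOL-Probability.Probability"
begin

datatype 'n lp_tree =
    Leaf 'n
  | Inner (exponent: real) (children: "'n lp_tree list")

fun leaves :: "'n lp_tree \<Rightarrow> 'n list" where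
  "leaves (Leaf i) = [i]"
| "leaves (Inner p ts) = concat (map leaves ts)"

fun well_formed :: "'n lp_tree \<Rightarrow> bool" where
  "well_formed (Leaf i) \<longleftrightarrow> True"
| "well_formed (Inner p ts) \<longleftrightarrow>
     p > 0 \<and> length ts \<ge> 2 \<and> (\<forall>t \<in> set ts. well_formed t)"

text \<open>
  The coordinates of \<open>real ^ 'n\<close> are numbered \<open>x\<^sub>1, \<dots>, x\<^sub>n\<close> in the order
  in which the leaves of the tree are read from left to right; hence the leaf labels
  must enumerate the index type without repetition.
\<close>

definition lp_nested_tree :: "'n::finite lp_tree \<Rightarrow> bool" where
  "lp_nested_tree t \<longleftrightarrow> well_formed t \<and> distinct (leaves t) \<and> set (leaves t) = UNIV"

fun lp_nested :: "'n::finite lp_tree \<Rightarrow> real ^ 'n \<Rightarrow> real" where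
  "lp_nested (Leaf i) x = \<bar>x $ i\<bar>"
| "lp_nested (Inner p ts) x = (\<Sum>t\<leftarrow>ts. lp_nested t x powr p) powr (1 / p)"

text \<open>
  A node is addressed by the multi-index of the path from the root, the root being \<open>[]\<close>.
  Children are counted from 1, so the children of an inner node \<open>I\<close> with \<open>l\<close> children
  are \<open>I @ [1], \<dots>, I @ [l]\<close>.
\<close>

function inner_nodes :: "'n lp_tree \<Rightarrow> nat list set" where
  "inner_nodes (Leaf i) = {}"
| "inner_nodes (Inner p ts) =
     insert [] (\<Union>k\<in>{1..length ts}. (\<lambda>I. k # I) ` inner_nodes (ts ! (k - 1)))"
  by pat_completeness auto
termination
proof (relation "Wellfounded.measure size")
  fix p :: real and ts :: "'n lp_tree list" and k :: nat
  assume "k \<in> {1..length ts}"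
  then have "ts ! (k - 1) \<in> set ts"
    by (intro nth_mem) auto
  then have "size (ts ! (k - 1)) < Suc (size_list size ts)"
    by (simp add: size_list_estimation' le_imp_less_Suc)
  then show "(ts ! (k - 1), Inner p ts) \<in> Wellfounded.measure size"
    by simp
qed simp

fun subtree :: "'n lp_tree \<Rightarrow> nat list \<Rightarrow> 'n lp_tree" where
  "subtree t [] = t"
| "subtree t (k # I) = subtree (children t ! (k - 1)) I"

definition node_exponent :: "'n lp_tree \<Rightarrow> nat list \<Rightarrow> real" where
  "node_exponent t I = exponent (subtree t I)"

definition num_children :: "'n lp_tree \<Rightarrow> nat list \<Rightarrow> nat" where
  "num_children t I = length (children (subtree t I))"

definition num_leaves :: "'n lp_tree \<Rightarrow> nat list \<Rightarrow> nat" where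
  "num_leaves t I = length (leaves (subtree t I))"

definition volume :: "(real ^ 'n::finite \<Rightarrow> real) \<Rightarrow> real \<Rightarrow> real" where
  "volume f R = measure lborel {x. f x \<le> R}"

definition surface :: "(real ^ 'n::finite \<Rightarrow> real) \<Rightarrow> real \<Rightarrow> real" where
  "surface f R = deriv (volume f) R"

definition lebesgue_density :: "(real ^ 'n::finite) measure \<Rightarrow> (real ^ 'n \<Rightarrow> real) \<Rightarrow> bool" where
  "lebesgue_density \<mu> h \<longleftrightarrow>
     h \<in> borel_measurable borel \<and> (\<forall>x. 0 \<le> h x) \<and> \<mu> = density lborel (\<lambda>x. ennreal (h x))"

definition symmetric_wrt :: "(real ^ 'n::finite \<Rightarrow> real) \<Rightarrow> (real ^ 'n) measure \<Rightarrow> bool" where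
  "symmetric_wrt f \<mu> \<longleftrightarrow> prob_space \<mu> \<and> (\<exists>g :: real \<Rightarrow> real. lebesgue_density \<mu> (\<lambda>x. g (f x)))"

text \<open>
  A density on \<open>(0, \<infinity>)\<close> is represented by a total function whose values outside
  \<open>(0, \<infinity>)\<close> are irrelevant.
\<close>

definition prob_density_pos :: "(real \<Rightarrow> real) \<Rightarrow> bool" where
  "prob_density_pos r \<longleftrightarrow>
     r \<in> borel_measurable (restrict_space borel {0<..}) \<and> (\<forall>s>0. 0 \<le> r s) \<and>
     (\<integral>\<^sup>+s\<in>{0<..}. ennreal (r s) \<partial>lborel) = 1"

definition radial_density ::
    "(real ^ 'n::finite \<Rightarrow> real) \<Rightarrow> (real ^ 'n) measure \<Rightarrow> (real \<Rightarrow> real) \<Rightarrow> bool" where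
  "radial_density f \<mu> r \<longleftrightarrow>
     distributed \<mu> lborel f (\<lambda>s. ennreal (r s) * indicator {0<..} s)"

definition symmetric_distribution ::
    "(real ^ 'n::finite \<Rightarrow> real) \<Rightarrow> (real \<Rightarrow> real) \<Rightarrow> (real ^ 'n) measure \<Rightarrow> bool" where
  "symmetric_distribution f r \<mu> \<longleftrightarrow> symmetric_wrt f \<mu> \<and> radial_density f \<mu> r"

end

theory Submission imports Defs begin

text \<open>
  Under Lebesgue measure on the coordinates of a subtree with \<open>m\<close> leaves, \<open>f\<^sub>I\<close> has density
  \<open>S\<^sub>I s\<^bsup>m-1\<^esup>\<close> on \<open>(0, \<infinity>)\<close>. Raising to the power \<open>p\<close> turns a density \<open>S s\<^bsup>a-1\<^esup>\<close> into
  \<open>(S/p) s\<^bsup>a/p-1\<^esup>\<close>, and adding functions of disjoint sets of coordinates convolves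
  the densities \<open>S s\<^bsup>a-1\<^esup>\<close> and \<open>T s\<^bsup>b-1\<^esup>\<close> to \<open>S T B(a, b) s\<^bsup>a+b-1\<^esup>\<close>.
  Running through the tree gives the product of Beta values for \<open>S\<^sub>f(1)\<close>. Comparing the density
  \<open>g(s) S\<^sub>f(1) s\<^bsup>n-1\<^esup>\<close> of \<open>f(X)\<close> with the radial density then determines \<open>g\<close> almost everywhere.
\<close>

section \<open>Integrals of powers over the half-line\<close>

lemma nn_integral_powr_from_0:
  fixes a S :: real
  assumes "a > 0" "S \<ge> 0"
  shows "(\<integral>\<^sup>+s. ennreal (S * s powr (a - 1)) * indicator {0<..c} s \<partial>lborel) = ennreal (S / a * max 0 c powr a)"
proof (cases "c \<le> 0")
  case True
  then show ?thesis using assms by (simp add: max_def)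
next
  case False
  have "((\<lambda>s. s powr (a - 1)) has_integral (c powr a / a)) {0..c}"
    using has_integral_powr_from_0[of "a - 1" c] assms False by simp
  then have "((\<lambda>s. S * s powr (a - 1)) has_integral (S * (c powr a / a))) {0..c}"
    by (rule has_integral_mult_right)
  then have "(\<integral>\<^sup>+s. ennreal (indicator {0..c} s * (S * s powr (a - 1))) \<partial>lborel) = ennreal (S * (c powr a / a))"
    by (intro nn_integral_has_integral_lebesgue) (use assms in auto)
  moreover have "ennreal (indicator {0..c} s * (S * s powr (a - 1))) =
      ennreal (S * s powr (a - 1)) * indicator {0<..c} s" for s
    using assms False by (auto simp: indicator_def)
  ultimately show ?thesis using False by (simp add: max_def)
qed

text \<open>The substitution \<open>s = c * u\<close> turns this into Euler's Beta integral over the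
  unit interval. The truncation by \<open>max 0\<close> cuts the integrand off at \<open>c\<close>,
  since \<open>0 powr y = 0\<close> for every \<open>y\<close>.\<close>

lemma nn_integral_Beta_scaled:
  fixes a b c :: real
  assumes "a > 0" "b > 0" "c > 0"
  shows "(\<integral>\<^sup>+s. ennreal (s powr (a - 1) * max 0 (c - s) powr (b - 1)) * indicator {0<..} s \<partial>lborel)
    = ennreal (c powr (a + b - 1) * Beta a b)"
proof -
  have scale: "ennreal ((c * s) powr (a - 1) * max 0 (c - c * s) powr (b - 1)) * indicator {0<..} (c * s) =
      ennreal (c powr (a + b - 2)) * ennreal (indicator {0..1} s * (s powr (a - 1) * (1 - s) powr (b - 1)))" for s
  proof (cases "0 < s \<and> s \<le> 1")
    case True
    then have "max 0 (c - c * s) = c * (1 - s)"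
      using assms by (simp add: max_def algebra_simps)
    moreover have "c powr (a + b - 2) = c powr (a - 1) * c powr (b - 1)"
      by (simp add: powr_add[symmetric])
    ultimately show ?thesis
      using True assms by (simp add: powr_mult ennreal_mult[symmetric] mult_ac)
  next
    case False
    moreover have "s \<le> 0 \<or> s > 1" using False by auto
    moreover have "s > 1 \<Longrightarrow> max 0 (c - c * s) = 0"
      using assms by (simp add: max_def)
    ultimately show ?thesis using assms by (auto simp: indicator_def zero_less_mult_iff)
  qed
  have "(\<integral>\<^sup>+s. ennreal (s powr (a - 1) * max 0 (c - s) powr (b - 1)) * indicator {0<..} s \<partial>lborel)
    = ennreal c * (\<integral>\<^sup>+s. ennreal ((c * s) powr (a - 1) * max 0 (c - c * s) powr (b - 1)) * indicator {0<..} (c * s) \<partial>lborel)"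
    using nn_integral_real_affine[of "\<lambda>s. ennreal (s powr (a - 1) * max 0 (c - s) powr (b - 1)) * indicator {0<..} s" c 0] assms
    by simp
  also have "\<dots> = ennreal c * (\<integral>\<^sup>+s. ennreal (c powr (a + b - 2)) *
      ennreal (indicator {0..1} s * (s powr (a - 1) * (1 - s) powr (b - 1))) \<partial>lborel)"
    by (simp only: scale)
  also have "\<dots> = ennreal c * (ennreal (c powr (a + b - 2)) * ennreal (Beta a b))"
    using nn_integral_has_integral_lebesgue[OF _ has_integral_Beta_real[OF assms(1,2)]]
    by (subst nn_integral_cmult) auto
  also have "\<dots> = ennreal (c * c powr (a + b - 2) * Beta a b)"
    using assms by (simp add: ennreal_mult[symmetric] Beta_def mult.assoc Gamma_real_pos less_imp_le)
  also have "c * c powr (a + b - 2) = c powr (a + b - 1)"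
    using assms powr_add[of c 1 "a + b - 2"] by simp
  finally show ?thesis .
qed

section \<open>Functions whose sublevel sets grow like a power\<close>

text \<open>
  Stated through sublevel sets, and not as a density \<open>S s\<^bsup>a-1\<^esup>\<close>, so that passing from
  \<open>g\<close> to \<open>g\<^sup>p\<close> needs no change of variables.
\<close>

definition power_law :: "'a measure \<Rightarrow> ('a \<Rightarrow> real) \<Rightarrow> real \<Rightarrow> real \<Rightarrow> bool" where
  "power_law M g S a \<longleftrightarrow> g \<in> borel_measurable M \<and> (\<forall>x\<in>space M. 0 \<le> g x) \<and> 0 < S \<and> 0 < a \<and>
     (\<forall>c. emeasure M {x \<in> space M. g x \<le> c} = ennreal (S / a * max 0 c powr a))"

lemma power_law_measurable: "power_law M g S a \<Longrightarrow> g \<in> borel_measurable M"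
  by (simp add: power_law_def)

text \<open>The half-lines \<open>{..c}\<close> are stable under intersection, generate the Borel
  sets, and countably many of them, each of finite measure, cover the line; so it is enough to
  compare both measures on half-lines.\<close>

lemma power_law_distr:
  assumes "power_law M g S a"
  shows "distr M borel g = density lborel (\<lambda>s. ennreal (S * s powr (a - 1)) * indicator {0<..} s)"
    (is "_ = ?D")
proof -
  have g[measurable]: "g \<in> borel_measurable M" and S: "S > 0" and a: "a > 0"
    and E: "\<And>c. emeasure M {x \<in> space M. g x \<le> c} = ennreal (S / a * max 0 c powr a)"
    using assms by (auto simp: power_law_def)
  have l: "emeasure (distr M borel g) {..c} = ennreal (S / a * max 0 c powr a)" for c
    unfolding E[symmetric] by (subst emeasure_distr) (auto intro!: arg_cong[where f = "emeasure M"])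
  have r: "emeasure ?D {..c} = ennreal (S / a * max 0 c powr a)" for c
  proof -
    have "emeasure ?D {..c} = (\<integral>\<^sup>+s. ennreal (S * s powr (a - 1)) * indicator {0<..} s * indicator {..c} s \<partial>lborel)"
      by (subst emeasure_density) auto
    also have "\<dots> = (\<integral>\<^sup>+s. ennreal (S * s powr (a - 1)) * indicator {0<..c} s \<partial>lborel)"
      by (intro nn_integral_cong) (auto simp: indicator_def)
    finally show ?thesis using nn_integral_powr_from_0[OF a, of S c] S by simp
  qed
  show ?thesis
  proof (rule measure_eqI_generator_eq[where \<Omega> = UNIV and E = "range (\<lambda>c::real. {..c})" and A = "\<lambda>i. {..real i}"])
    show "Int_stable (range (\<lambda>c::real. {..c}))"
      by (auto simp: Int_stable_def)
    show "sets (distr M borel g) = sigma_sets UNIV (range (\<lambda>c::real. {..c}))"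
      by (simp add: borel_eq_atMost)
    show "sets ?D = sigma_sets UNIV (range (\<lambda>c::real. {..c}))"
      by (simp add: borel_eq_atMost)
    show "(\<Union>i. {..real i}) = UNIV"
      by (auto intro: real_arch_simple)
  qed (auto simp: l r)
qed

text \<open>For \<open>c\<close> nonnegative, a bound \<open>c\<close> on the power is a bound
  \<open>c powr (1 / p)\<close> on \<open>g\<close>, which divides the exponent \<open>a\<close> by
  \<open>p\<close>. Dividing \<open>S\<close> by \<open>p\<close> as well keeps the quotient
  \<open>S / a\<close>.\<close>

lemma power_law_powr:
  assumes "power_law M g S a" "p > 0"
  shows "power_law M (\<lambda>x. g x powr p) (S / p) (a / p)"
proof -
  have g[measurable]: "g \<in> borel_measurable M" and S: "S > 0" and a: "a > 0"
    and pos: "\<And>x. x \<in> space M \<Longrightarrow> 0 \<le> g x"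
    and E: "\<And>c. emeasure M {x \<in> space M. g x \<le> c} = ennreal (S / a * max 0 c powr a)"
    using assms by (auto simp: power_law_def)
  have "emeasure M {x \<in> space M. g x powr p \<le> c} = ennreal (S / p / (a / p) * max 0 c powr (a / p))" for c
  proof (cases "c < 0")
    case True
    then have "{x \<in> space M. g x powr p \<le> c} = {}"
      using powr_ge_zero[of _ p] by (auto simp: not_le intro: less_le_trans)
    then show ?thesis using True a assms(2) by (simp only: emeasure_empty) (simp add: max_def)
  next
    case False
    have "g x powr p \<le> c \<longleftrightarrow> g x \<le> c powr (1 / p)" if "x \<in> space M" for x
    proof -
      have "c = (c powr (1 / p)) powr p"
        using False assms(2) by (simp add: powr_powr)
      then show ?thesis
        using pos[OF that] assms(2) powr_mono2[of p "g x" "c powr (1 / p)"]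
          powr_less_mono2[of p "c powr (1 / p)" "g x"]
        by fastforce
    qed
    then have "{x \<in> space M. g x powr p \<le> c} = {x \<in> space M. g x \<le> c powr (1 / p)}"
      by auto
    then show ?thesis
      using False assms(2) by (simp add: E powr_powr max_def)
  qed
  then show ?thesis
    using S a assms(2) by (auto simp: power_law_def)
qed

text \<open>By Tonelli: the slice of the sublevel set over \<open>x\<close> is the sublevel set of
  \<open>h\<close> at level \<open>c - g x\<close>, whose measure depends on \<open>g x\<close>
  alone. The outer integral can thus be taken against the law of \<open>g\<close>, where it is a
  Beta integral.\<close>

lemma power_law_add:
  assumes "power_law M g S a" "power_law N h T b" "sigma_finite_measure M" "sigma_finite_measure N"
  shows "power_law (M \<Otimes>\<^sub>M N) (\<lambda>z. g (fst z) + h (snd z)) (S * T * Beta a b) (a + b)"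
proof -
  interpret M: sigma_finite_measure M by fact
  interpret N: sigma_finite_measure N by fact
  interpret pair_sigma_finite M N ..
  have g[measurable]: "g \<in> borel_measurable M" and S: "S > 0" and a: "a > 0"
    and gpos: "\<And>x. x \<in> space M \<Longrightarrow> 0 \<le> g x"
    using assms(1) by (auto simp: power_law_def)
  have h[measurable]: "h \<in> borel_measurable N" and T: "T > 0" and b: "b > 0"
    and hpos: "\<And>x. x \<in> space N \<Longrightarrow> 0 \<le> h x"
    and E: "\<And>c. emeasure N {x \<in> space N. h x \<le> c} = ennreal (T / b * max 0 c powr b)"
    using assms(2) by (auto simp: power_law_def)
  have B: "Beta a b > 0" using a b by (simp add: Beta_def Gamma_real_pos)
  have "emeasure (M \<Otimes>\<^sub>M N) {z \<in> space (M \<Otimes>\<^sub>M N). g (fst z) + h (snd z) \<le> c} =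
      ennreal (S * T * Beta a b / (a + b) * max 0 c powr (a + b))" for c
  proof -
    have "emeasure (M \<Otimes>\<^sub>M N) {z \<in> space (M \<Otimes>\<^sub>M N). g (fst z) + h (snd z) \<le> c} =
      (\<integral>\<^sup>+x. emeasure N (Pair x -` {z \<in> space (M \<Otimes>\<^sub>M N). g (fst z) + h (snd z) \<le> c}) \<partial>M)"
      by (rule N.emeasure_pair_measure_alt) measurable
    also have "\<dots> = (\<integral>\<^sup>+x. ennreal (T / b * max 0 (c - g x) powr b) \<partial>M)"
    proof (rule nn_integral_cong)
      fix x assume "x \<in> space M"
      then have "Pair x -` {z \<in> space (M \<Otimes>\<^sub>M N). g (fst z) + h (snd z) \<le> c} = {y \<in> space N. h y \<le> c - g x}"
        by (auto simp: space_pair_measure)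
      then show "emeasure N (Pair x -` {z \<in> space (M \<Otimes>\<^sub>M N). g (fst z) + h (snd z) \<le> c}) =
          ennreal (T / b * max 0 (c - g x) powr b)"
        by (simp only: E)
    qed
    also have "\<dots> = (\<integral>\<^sup>+s. ennreal (T / b * max 0 (c - s) powr b) \<partial>distr M borel g)"
      by (subst nn_integral_distr) auto
    also have "\<dots> = (\<integral>\<^sup>+s. ennreal (S * s powr (a - 1)) * indicator {0<..} s * ennreal (T / b * max 0 (c - s) powr b) \<partial>lborel)"
      unfolding power_law_distr[OF assms(1)] by (subst nn_integral_density) auto
    \<comment> \<open>The exponent \<open>b\<close> is written as \<open>(b + 1) - 1\<close> because
      the slices carry the integrated law of \<open>h\<close>, so the Beta integral has parameters
      \<open>a\<close> and \<open>b + 1\<close>.\<close>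
    also have "\<dots> = (\<integral>\<^sup>+s. ennreal (S * T / b) * (ennreal (s powr (a - 1) * max 0 (c - s) powr ((b + 1) - 1)) * indicator {0<..} s) \<partial>lborel)"
      using S T b by (intro nn_integral_cong) (auto simp: ennreal_mult[symmetric] indicator_def mult_ac)
    also have "\<dots> = ennreal (S * T / b) * (\<integral>\<^sup>+s. ennreal (s powr (a - 1) * max 0 (c - s) powr ((b + 1) - 1)) * indicator {0<..} s \<partial>lborel)"
      by (rule nn_integral_cmult) measurable
    also have "\<dots> = ennreal (S * T * Beta a b / (a + b) * max 0 c powr (a + b))"
    proof (cases "c > 0")
      case True
      \<comment> \<open>The functional equation of Gamma lowers \<open>b + 1\<close> back to
        \<open>b\<close>: the new factor \<open>b\<close> cancels against \<open>T / b\<close>, and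
        \<open>a + b\<close> is the divisor that \<open>power_law\<close> asks for.\<close>
      have "Gamma (b + 1) = b * Gamma b" "Gamma (a + b + 1) = (a + b) * Gamma (a + b)"
        using a b nonpos_Ints_nonpos[of b] nonpos_Ints_nonpos[of "a + b"]
        by (force intro!: Gamma_plus1)+
      then have "Beta a (b + 1) = Beta a b * b / (a + b)"
        unfolding Beta_def by (simp add: add.assoc[symmetric] mult_ac)
      then show ?thesis
        using True S T a b B
        by (simp only: nn_integral_Beta_scaled[OF a _ True, of "b + 1"] add_pos_pos zero_less_one)
          (simp add: ennreal_mult[symmetric] max_def field_simps)
    next
      case False
      have "(\<integral>\<^sup>+s. ennreal (s powr (a - 1) * max 0 (c - s) powr ((b + 1) - 1)) * indicator {0<..} s \<partial>lborel) = (\<integral>\<^sup>+s. 0 \<partial>(lborel :: real measure))"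
        using False by (intro nn_integral_cong) (auto simp: indicator_def max_def)
      then show ?thesis using False by (simp add: max_def)
    qed
    finally show ?thesis .
  qed
  then show ?thesis
    using S T a b B gpos hpos by (auto simp: power_law_def space_pair_measure)
qed

text \<open>Moves laws along \<open>merge\<close>, along a single coordinate and along
  \<open>vec_lambda\<close>. Nonnegativity of \<open>g\<close> is assumed on all of \<open>N\<close>
  because the right-hand side sees only the range of \<open>f\<close>.\<close>

lemma power_law_distr_iff:
  assumes f: "f \<in> M \<rightarrow>\<^sub>M N" and g: "g \<in> borel_measurable N"
    and pos: "\<And>y. y \<in> space N \<Longrightarrow> 0 \<le> g y"
  shows "power_law (distr M N f) g S a \<longleftrightarrow> power_law M (\<lambda>x. g (f x)) S a"
proof -
  have "emeasure (distr M N f) {y \<in> space N. g y \<le> c} = emeasure M {x \<in> space M. g (f x) \<le> c}" for c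
    using f g by (subst emeasure_distr)
      (auto intro!: arg_cong[where f = "emeasure M"] dest: measurable_space)
  then show ?thesis
    using f g pos measurable_space[OF f] by (auto simp: power_law_def)
qed

lemma power_law_cong:
  assumes "\<And>x. x \<in> space M \<Longrightarrow> g x = h x"
  shows "power_law M g S a \<longleftrightarrow> power_law M h S a"
proof -
  have "g \<in> borel_measurable M \<longleftrightarrow> h \<in> borel_measurable M"
    by (rule measurable_cong) (rule assms)
  moreover have "{x \<in> space M. g x \<le> c} = {x \<in> space M. h x \<le> c}" for c
    using assms by auto
  ultimately show ?thesis
    using assms by (simp add: power_law_def)
qed

section \<open>Functions of disjoint groups of coordinates\<close>

text \<open>The argument is a total assignment, so that one and the same function can be studied on
  \<open>PiM A M\<close> for every index set containing the coordinates it reads.\<close>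

definition depends_on :: "'i set \<Rightarrow> (('i \<Rightarrow> 'b) \<Rightarrow> 'c) \<Rightarrow> bool" where
  "depends_on A g \<longleftrightarrow> (\<forall>x y. (\<forall>i\<in>A. x i = y i) \<longrightarrow> g x = g y)"

lemma depends_onD: "depends_on A g \<Longrightarrow> (\<And>i. i \<in> A \<Longrightarrow> x i = y i) \<Longrightarrow> g x = g y"
  by (auto simp: depends_on_def)

lemma depends_on_mono: "depends_on A g \<Longrightarrow> A \<subseteq> B \<Longrightarrow> depends_on B g"
  by (auto simp: depends_on_def)

lemma depends_on_sum:
  "(\<And>k. k \<in> K \<Longrightarrow> depends_on A (g k)) \<Longrightarrow> depends_on A (\<lambda>x. \<Sum>k\<in>K. g k x)"
  by (auto simp: depends_on_def intro!: sum.cong)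

lemma depends_on_measurable:
  assumes "depends_on A g" "g \<in> borel_measurable (PiM A M)" "A \<subseteq> B"
  shows "g \<in> borel_measurable (PiM B M)"
proof -
  have "(\<lambda>x. g (restrict x A)) \<in> borel_measurable (PiM B M)"
    by (rule measurable_compose[OF measurable_restrict_subset assms(2)]) fact
  moreover have "g (restrict x A) = g x" for x
    using assms(1) by (simp add: depends_on_def)
  ultimately show ?thesis by simp
qed

abbreviation coord_law :: "'i set \<Rightarrow> (('i \<Rightarrow> real) \<Rightarrow> real) \<Rightarrow> real \<Rightarrow> real \<Rightarrow> bool" where
  "coord_law A \<equiv> power_law (PiM A (\<lambda>_. lborel))"

text \<open>\<open>merge A B\<close> carries the product of the two coordinate measures to the
  measure on the union. After merging, \<open>g\<close> reads only the first component and, by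
  disjointness, \<open>h\<close> only the second.\<close>

lemma coord_law_add:
  assumes "coord_law A g S a" "coord_law B h T b" "depends_on A g" "depends_on B h"
    and "finite A" "finite B" "A \<inter> B = {}" and nonneg: "\<And>x. 0 \<le> g x" "\<And>x. 0 \<le> h x"
  shows "coord_law (A \<union> B) (\<lambda>x. g x + h x) (S * T * Beta a b) (a + b)"
proof -
  interpret product_sigma_finite "\<lambda>_ :: 'a. lborel :: real measure" ..
  let ?M = "\<lambda>A. PiM A (\<lambda>_ :: 'a. lborel :: real measure)"
  have m: "(\<lambda>x. g x + h x) \<in> borel_measurable (?M (A \<union> B))"
  proof (rule borel_measurable_add)
    show "g \<in> borel_measurable (?M (A \<union> B))"
      by (rule depends_on_measurable[OF assms(3) power_law_measurable[OF assms(1)]]) simp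
    show "h \<in> borel_measurable (?M (A \<union> B))"
      by (rule depends_on_measurable[OF assms(4) power_law_measurable[OF assms(2)]]) simp
  qed
  have "g (merge A B z) = g (fst z)" "h (merge A B z) = h (snd z)" for z
    using assms(7) by (auto intro!: depends_onD[OF assms(3)] depends_onD[OF assms(4)]
        simp: merge_def split: prod.splits)
  then have "power_law (?M A \<Otimes>\<^sub>M ?M B) (\<lambda>z. g (merge A B z) + h (merge A B z)) (S * T * Beta a b) (a + b)"
    using power_law_add[OF assms(1,2) sigma_finite[OF assms(5)] sigma_finite[OF assms(6)]]
    by simp
  then have "power_law (distr (?M A \<Otimes>\<^sub>M ?M B) (?M (A \<union> B)) (merge A B))
      (\<lambda>x. g x + h x) (S * T * Beta a b) (a + b)"
    using m nonneg by (subst power_law_distr_iff) (auto intro: add_nonneg_nonneg)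
  then show ?thesis
    by (simp only: distr_merge[OF assms(7,5,6)])
qed

text \<open>The summands are joined one at a time; joining number \<open>j\<close> to the partial
  sum before it contributes one Beta value. The induction starts from one summand because
  \<open>power_law\<close> demands a positive exponent, which an empty sum lacks.\<close>

lemma coord_law_sum:
  fixes k :: nat
  assumes "\<And>i. i \<le> k \<Longrightarrow> coord_law (A i) (g i) (S i) (a i)" "\<And>i. i \<le> k \<Longrightarrow> depends_on (A i) (g i)"
    and "\<And>i. i \<le> k \<Longrightarrow> finite (A i)" "\<And>i j. i < j \<Longrightarrow> j \<le> k \<Longrightarrow> A i \<inter> A j = {}"
    and "\<And>i x. i \<le> k \<Longrightarrow> 0 \<le> g i x"
  shows "coord_law (\<Union>i\<le>k. A i) (\<lambda>x. \<Sum>i\<le>k. g i x)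
    ((\<Prod>i\<le>k. S i) * (\<Prod>j = 1..k. Beta (\<Sum>i<j. a i) (a j))) (\<Sum>i\<le>k. a i)"
  using assms
proof (induction k)
  case 0
  then show ?case by simp
next
  case (Suc k)
  have "coord_law ((\<Union>i\<le>k. A i) \<union> A (Suc k)) (\<lambda>x. (\<Sum>i\<le>k. g i x) + g (Suc k) x)
    (((\<Prod>i\<le>k. S i) * (\<Prod>j = 1..k. Beta (\<Sum>i<j. a i) (a j))) * S (Suc k) * Beta (\<Sum>i\<le>k. a i) (a (Suc k)))
    ((\<Sum>i\<le>k. a i) + a (Suc k))"
  proof (rule coord_law_add)
    show "depends_on (\<Union>i\<le>k. A i) (\<lambda>x. \<Sum>i\<le>k. g i x)"
      by (intro depends_on_sum depends_on_mono[OF Suc.prems(2)]) auto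
    show "(\<Union>i\<le>k. A i) \<inter> A (Suc k) = {}"
    proof -
      have "A i \<inter> A (Suc k) = {}" if "i \<le> k" for i
        using that by (intro Suc.prems(4)) auto
      then show ?thesis by auto
    qed
    show "coord_law (\<Union>i\<le>k. A i) (\<lambda>x. \<Sum>i\<le>k. g i x)
      ((\<Prod>i\<le>k. S i) * (\<Prod>j = 1..k. Beta (\<Sum>i<j. a i) (a j))) (\<Sum>i\<le>k. a i)"
    proof (rule Suc.IH)
      fix i j assume "i < j" "j \<le> k"
      then show "A i \<inter> A j = {}" by (intro Suc.prems(4)) auto
    qed (auto intro: Suc.prems(1-3,5))
    show "coord_law (A (Suc k)) (g (Suc k)) (S (Suc k)) (a (Suc k))"
      by (rule Suc.prems(1)) simp
    show "depends_on (A (Suc k)) (g (Suc k))"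
      by (rule Suc.prems(2)) simp
    show "finite (A (Suc k))" "finite (\<Union>i\<le>k. A i)"
      by (auto intro: Suc.prems(3))
    show "0 \<le> (\<Sum>i\<le>k. g i x)" for x
      by (intro sum_nonneg Suc.prems(5)) auto
    show "0 \<le> g (Suc k) x" for x
      by (rule Suc.prems(5)) simp
  qed
  then show ?case
    by (simp add: lessThan_Suc_atMost atMost_Suc Un_commute add.commute mult_ac)
qed

section \<open>Lebesgue measure on vectors as a product measure\<close>

lemma measurable_vec_lambda[measurable]:
  "vec_lambda \<in> PiM UNIV (\<lambda>_. lborel) \<rightarrow>\<^sub>M (borel :: (real ^ 'n::finite) measure)"
  by (subst borel_measurable_euclidean_space) (auto simp: Basis_vec_def inner_axis)

text \<open>Lebesgue measure is determined by the volumes of boxes, and the preimage of a box under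
  \<open>vec_lambda\<close> is a product of intervals.\<close>

lemma lborel_eq_distr_vec_lambda:
  "(lborel :: (real ^ 'n::finite) measure) = distr (PiM UNIV (\<lambda>_. lborel)) borel vec_lambda"
proof (rule lborel_eqI)
  interpret product_sigma_finite "\<lambda>_ :: 'n. lborel :: real measure" ..
  interpret finite_product_sigma_finite "\<lambda>_ :: 'n. lborel :: real measure" UNIV
    by standard simp
  fix l u :: "real ^ 'n"
  assume le: "\<And>b. b \<in> Basis \<Longrightarrow> l \<bullet> b \<le> u \<bullet> b"
  have le': "l $ i \<le> u $ i" for i
    using le[of "axis i 1"] by (auto simp: inner_axis Basis_vec_def)
  have "emeasure (distr (PiM UNIV (\<lambda>_. lborel)) borel vec_lambda) (box l u) =
      emeasure (PiM UNIV (\<lambda>_. lborel)) (\<Pi>\<^sub>E i\<in>UNIV. {l $ i<..<u $ i})"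
    by (subst emeasure_distr)
      (auto simp: mem_box_cart space_PiM PiE_def Pi_iff intro!: arg_cong[where f = "emeasure _"])
  also have "\<dots> = (\<Prod>i\<in>UNIV. ennreal (u $ i - l $ i))"
    by (subst measure_times) (auto simp: le')
  also have "\<dots> = ennreal (\<Prod>i\<in>UNIV. u $ i - l $ i)"
    by (rule prod_ennreal) (simp add: le')
  also have "(\<Prod>i\<in>UNIV. u $ i - l $ i) = (\<Prod>b\<in>Basis. (u - l) \<bullet> b)"
    by (simp add: Basis_vec_def cart_eq_inner_axis axis_eq_axis prod.UNION_disjoint inner_diff_left)
  finally show "emeasure (distr (PiM UNIV (\<lambda>_. lborel)) borel vec_lambda) (box l u) =
      ennreal (\<Prod>b\<in>Basis. (u - l) \<bullet> b)" .
qed simp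

section \<open>Coordinates read by nested functions\<close>

lemma lp_nested_nonneg: "0 \<le> lp_nested t x"
  by (cases t) auto

lemma depends_on_lp_nested: "depends_on (set (leaves t)) (\<lambda>x. lp_nested t (vec_lambda x))"
proof -
  have "lp_nested t (vec_lambda x) = lp_nested t (vec_lambda y)"
    if "\<forall>i\<in>set (leaves t). x i = y i" for x y
    using that
  proof (induction t)
    case (Inner p ts)
    then have "map (\<lambda>t. lp_nested t (vec_lambda x) powr p) ts = map (\<lambda>t. lp_nested t (vec_lambda y) powr p) ts"
      by (intro map_cong) auto
    then show ?case by (simp only: lp_nested.simps)
  qed simp
  then show ?thesis by (auto simp: depends_on_def)
qed

text \<open>Supplies the disjointness of the leaf sets of different children of a node.\<close>

lemma disjoint_nth_if_distinct_concat:
  "distinct (concat xss) \<Longrightarrow> i < j \<Longrightarrow> j < length xss \<Longrightarrow> set (xss ! i) \<inter> set (xss ! j) = {}"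
proof (induction xss arbitrary: i j)
  case (Cons xs xss)
  then obtain j' where j: "j = Suc j'" by (cases j) auto
  show ?case
  proof (cases i)
    case 0
    have "set (xss ! j') \<subseteq> set (concat xss)"
      using Cons.prems j by (auto intro!: bexI[of _ "xss ! j'"])
    then show ?thesis using Cons.prems j 0 by auto
  next
    case (Suc i')
    then show ?thesis using Cons.IH[of i' j'] Cons.prems j by auto
  qed
qed simp

section \<open>The factors of the inner nodes\<close>

text \<open>The factor of the node in the density formula; its reciprocal is the contribution of the
  node to \<open>surface f 1\<close>.\<close>

definition node_factor :: "'n lp_tree \<Rightarrow> nat list \<Rightarrow> real" where
  "node_factor t I = node_exponent t I ^ (num_children t I - 1) *
     (\<Prod>k = 1..num_children t I - 1.
        inverse (Beta (real (\<Sum>i = 1..k. num_leaves t (I @ [i])) / node_exponent t I)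
                      (real (num_leaves t (I @ [k + 1])) / node_exponent t I)))"

lemma finite_inner_nodes: "finite (inner_nodes t)"
  by (induction t rule: inner_nodes.induct) auto

lemma node_factor_child: "node_factor (Inner p ts) (k # I) = node_factor (ts ! (k - 1)) I"
  by (simp add: node_factor_def node_exponent_def num_children_def num_leaves_def)

text \<open>Addresses count children from 1 and lists from 0; the shift brings the Beta arguments
  into the form produced by \<open>coord_law_sum\<close>.\<close>

lemma node_factor_root:
  "node_factor (Inner p ts) [] = p ^ (length ts - 1) *
     (\<Prod>k = 1..length ts - 1. inverse (Beta (\<Sum>i<k. real (length (leaves (ts ! i))) / p)
        (real (length (leaves (ts ! k))) / p)))"
proof -
  have "(\<Sum>i = 1..k. length (leaves (ts ! (i - 1)))) = (\<Sum>i<k. length (leaves (ts ! i)))" for k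
    by (simp add: sum.atLeast1_atMost_eq)
  then show ?thesis
    by (simp add: node_factor_def node_exponent_def num_children_def num_leaves_def sum_divide_distrib)
qed

text \<open>The inner nodes below the root split by the first entry of their address, and prefixing
  that entry is injective.\<close>

lemma prod_node_factor_Inner:
  "(\<Prod>I\<in>inner_nodes (Inner p ts). node_factor (Inner p ts) I) =
     node_factor (Inner p ts) [] * (\<Prod>k<length ts. \<Prod>I\<in>inner_nodes (ts ! k). node_factor (ts ! k) I)"
proof -
  have "(\<Prod>I\<in>inner_nodes (Inner p ts). node_factor (Inner p ts) I) =
     node_factor (Inner p ts) [] *
     (\<Prod>I\<in>(\<Union>k\<in>{1..length ts}. (#) k ` inner_nodes (ts ! (k - 1))). node_factor (Inner p ts) I)"
    by (subst inner_nodes.simps, subst prod.insert) (auto simp: finite_inner_nodes)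
  also have "(\<Prod>I\<in>(\<Union>k\<in>{1..length ts}. (#) k ` inner_nodes (ts ! (k - 1))). node_factor (Inner p ts) I) =
     (\<Prod>k = 1..length ts. \<Prod>I\<in>(#) k ` inner_nodes (ts ! (k - 1)). node_factor (Inner p ts) I)"
    by (rule prod.UNION_disjoint) (auto simp: finite_inner_nodes)
  also have "\<dots> = (\<Prod>k = 1..length ts. \<Prod>I\<in>inner_nodes (ts ! (k - 1)). node_factor (ts ! (k - 1)) I)"
    by (rule prod.cong[OF refl], subst prod.reindex) (auto simp: node_factor_child)
  also have "\<dots> = (\<Prod>k<length ts. \<Prod>I\<in>inner_nodes (ts ! k). node_factor (ts ! k) I)"
    by (simp add: prod.atLeast1_atMost_eq)
  finally show ?thesis .
qed

section \<open>The law of a nested function under Lebesgue measure\<close>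

text \<open>An interval from \<open>- c\<close> to \<open>c\<close> has length \<open>2 * c\<close>;
  this is the source of one factor 2 per coordinate.\<close>

lemma power_law_abs: "power_law lborel (abs :: real \<Rightarrow> real) 2 1"
proof -
  have "{x :: real. \<bar>x\<bar> \<le> c} = {- c..c}" for c by auto
  then show ?thesis
    by (auto simp: power_law_def max_def)
qed

text \<open>Induction on the tree: at an inner node the functions of the children are raised to the
  power \<open>p\<close>, added over disjoint sets of coordinates, and the sum is raised to
  \<open>1 / p\<close>.\<close>

lemma coord_law_lp_nested:
  assumes "well_formed t" "distinct (leaves t)"
  shows "coord_law (set (leaves t)) (\<lambda>x. lp_nested t (vec_lambda x))
    (2 ^ length (leaves t) / (\<Prod>I\<in>inner_nodes t. node_factor t I)) (real (length (leaves t)))"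
  using assms
proof (induction t)
  case (Leaf i)
  interpret product_sigma_finite "\<lambda>_ :: 'a. lborel :: real measure" ..
  have "power_law (distr (PiM {i} (\<lambda>_. lborel)) lborel (\<lambda>x. x i)) (abs :: real \<Rightarrow> real) 2 1"
    unfolding distr_singleton by (rule power_law_abs)
  then show ?case
    by (subst (asm) power_law_distr_iff) auto
next
  case (Inner p ts)
  \<comment> \<open>\<open>coord_law_sum\<close> numbers its summands from 0 to \<open>k\<close>, so
    \<open>k\<close> is one less than the number of children, which is also the exponent of
    \<open>p\<close> in the node factor.\<close>
  define k where "k = length ts - 1"
  have k: "length ts = Suc k" and p: "p > 0"
    using Inner.prems by (auto simp: k_def)
  define m where "m i = length (leaves (ts ! i))" for i
  define K where "K i = (\<Prod>I\<in>inner_nodes (ts ! i). node_factor (ts ! i) I)" for i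
  define b where "b = (\<Prod>j = 1..k. Beta (\<Sum>i<j. real (m i) / p) (real (m j) / p))"
  have child: "ts ! i \<in> set ts" if "i \<le> k" for i
    using that k by simp
  have "coord_law (set (leaves (ts ! i))) (\<lambda>x. lp_nested (ts ! i) (vec_lambda x) powr p)
      (2 ^ m i / K i / p) (real (m i) / p)" if "i \<le> k" for i
    unfolding m_def K_def using Inner.prems child[OF that] p
    by (intro power_law_powr Inner.IH) (auto simp: distinct_concat_iff)
  moreover have "depends_on (set (leaves t)) (\<lambda>x. lp_nested t (vec_lambda x) powr p)" for t :: "'a lp_tree"
    using depends_on_lp_nested[of t] unfolding depends_on_def by metis
  moreover have "set (leaves (ts ! i)) \<inter> set (leaves (ts ! j)) = {}" if "i < j" "j \<le> k" for i j
    using disjoint_nth_if_distinct_concat[of "map leaves ts" i j] Inner.prems that k by simp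
  ultimately have "coord_law (\<Union>i\<le>k. set (leaves (ts ! i))) (\<lambda>x. \<Sum>i\<le>k. lp_nested (ts ! i) (vec_lambda x) powr p)
     ((\<Prod>i\<le>k. 2 ^ m i / K i / p) * b) (\<Sum>i\<le>k. real (m i) / p)"
    unfolding b_def by (intro coord_law_sum) auto
  then have "coord_law (\<Union>i\<le>k. set (leaves (ts ! i))) (\<lambda>x. (\<Sum>i\<le>k. lp_nested (ts ! i) (vec_lambda x) powr p) powr (1 / p))
     ((\<Prod>i\<le>k. 2 ^ m i / K i / p) * b / (1 / p)) ((\<Sum>i\<le>k. real (m i) / p) / (1 / p))"
    by (rule power_law_powr) (use p in simp)
  also have "(\<lambda>x. (\<Sum>i\<le>k. lp_nested (ts ! i) (vec_lambda x) powr p) powr (1 / p)) =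
      (\<lambda>x. lp_nested (Inner p ts) (vec_lambda x))"
    by (simp add: sum_list_sum_nth k atLeast0LessThan lessThan_Suc_atMost)
  also have "(\<Union>i\<le>k. set (leaves (ts ! i))) = set (leaves (Inner p ts))"
    by (force simp: in_set_conv_nth k less_Suc_eq_le)
  also have "(\<Sum>i\<le>k. real (m i) / p) / (1 / p) = real (length (leaves (Inner p ts)))"
    using p by (simp add: sum_divide_distrib[symmetric] length_concat sum_list_sum_nth k
        atLeast0LessThan lessThan_Suc_atMost m_def)
  \<comment> \<open>The \<open>k + 1\<close> children give \<open>k + 1\<close> divisions by
    \<open>p\<close> and the outer root one multiplication, which leaves a division by
    \<open>p ^ k\<close>.\<close>
  also have "(\<Prod>i\<le>k. 2 ^ m i / K i / p) * b / (1 / p) =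
      2 ^ length (leaves (Inner p ts)) / (\<Prod>I\<in>inner_nodes (Inner p ts). node_factor (Inner p ts) I)"
  proof -
    have "length (leaves (Inner p ts)) = (\<Sum>i\<le>k. m i)"
      by (simp add: length_concat sum_list_sum_nth k atLeast0LessThan lessThan_Suc_atMost m_def)
    then have "(\<Prod>i\<le>k. 2 ^ m i / K i / p) = 2 ^ length (leaves (Inner p ts)) / (\<Prod>i\<le>k. K i) / p ^ Suc k"
      by (simp add: prod_dividef prod.distrib power_sum)
    moreover have "(\<Prod>I\<in>inner_nodes (Inner p ts). node_factor (Inner p ts) I) = p ^ k * inverse b * (\<Prod>i\<le>k. K i)"
      unfolding prod_node_factor_Inner node_factor_root k b_def m_def K_def lessThan_Suc_atMost
      by (simp add: prod_inversef[symmetric] o_def)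
    ultimately show ?thesis using p by (simp add: field_simps)
  qed
  finally show ?case .
qed

lemma lp_nested_measurable:
  fixes t :: "'n::finite lp_tree"
  assumes "(\<lambda>x. lp_nested t (vec_lambda x)) \<in> borel_measurable (PiM UNIV (\<lambda>_. lborel))"
  shows "lp_nested t \<in> borel_measurable borel"
proof -
  have "vec_nth \<in> (borel :: (real ^ 'n) measure) \<rightarrow>\<^sub>M PiM UNIV (\<lambda>_. lborel)"
    by (rule measurable_PiM_single')
      (auto intro!: borel_measurable_continuous_onI continuous_intros simp: space_PiM)
  from measurable_compose[OF this assms] show ?thesis by simp
qed

text \<open>The leaves enumerate the index type, so the law on the leaf coordinates is a law on all
  coordinates, which \<open>vec_lambda\<close> transports to vectors.\<close>

lemma power_law_lp_nested:
  fixes t :: "'n::finite lp_tree"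
  assumes "lp_nested_tree t"
  shows "power_law lborel (lp_nested t) (2 ^ CARD('n) / (\<Prod>I\<in>inner_nodes t. node_factor t I)) (real CARD('n))"
proof -
  have t: "well_formed t" "distinct (leaves t)" "set (leaves t) = UNIV"
    using assms by (auto simp: lp_nested_tree_def)
  then have n: "length (leaves t) = CARD('n)"
    using distinct_card[of "leaves t"] by simp
  have law: "coord_law UNIV (\<lambda>x. lp_nested t (vec_lambda x))
      (2 ^ CARD('n) / (\<Prod>I\<in>inner_nodes t. node_factor t I)) (real CARD('n))"
    using coord_law_lp_nested[OF t(1,2)] unfolding n t(3) .
  show ?thesis
    unfolding lborel_eq_distr_vec_lambda
    by (subst power_law_distr_iff)
      (use law lp_nested_measurable[OF power_law_measurable[OF law]] in
        \<open>auto simp: measurable_vec_lambda lp_nested_nonneg\<close>)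
qed

section \<open>Homogeneity and the surface of the unit ball\<close>

lemma lp_nested_scaleR:
  assumes "well_formed t" "c \<ge> 0"
  shows "lp_nested t (c *\<^sub>R x) = c * lp_nested t x"
  using assms(1)
proof (induction t)
  case (Inner p ts)
  then have p: "p > 0" by simp
  have "map (\<lambda>t. lp_nested t (c *\<^sub>R x) powr p) ts = map (\<lambda>t. c powr p * lp_nested t x powr p) ts"
    using Inner assms(2) by (intro map_cong) (auto simp: powr_mult lp_nested_nonneg)
  then have "lp_nested (Inner p ts) (c *\<^sub>R x) = (c powr p * (\<Sum>t\<leftarrow>ts. lp_nested t x powr p)) powr (1 / p)"
    by (simp only: lp_nested.simps sum_list_const_mult)
  also have "\<dots> = c * lp_nested (Inner p ts) x"
    using p assms(2) by (subst powr_mult) (auto simp: powr_powr intro!: sum_list_nonneg)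
  finally show ?case .
qed (use assms(2) in \<open>simp add: abs_mult\<close>)

lemma surface_power_law:
  fixes f :: "real ^ 'n::finite \<Rightarrow> real"
  assumes "power_law lborel f S (real n)"
  shows "surface f 1 = S"
proof -
  have S: "S > 0" and n: "n > 0"
    and E: "\<And>c. emeasure lborel {x. f x \<le> c} = ennreal (S / real n * max 0 c powr real n)"
    using assms by (auto simp: power_law_def)
  have vol: "volume f R = S / real n * R ^ n" if "R \<in> {0<..}" for R
    unfolding volume_def measure_def E using that S n by (simp add: max_def powr_realpow)
  have "((\<lambda>R. S / real n * R ^ n) has_field_derivative S) (at 1)"
    by (rule derivative_eq_intros refl | use n in simp)+
  \<comment> \<open>The volume formula is proved for positive \<open>R\<close>, an open set around
    1, which suffices for the derivative at 1.\<close>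
  then have "(volume f has_field_derivative S) (at 1)"
    by (rule has_field_derivative_transform_within_open[of _ _ _ "{0<..}"]) (auto simp: vol)
  then show ?thesis
    unfolding surface_def by (rule DERIV_imp_deriv)
qed

section \<open>Existence and uniqueness of the symmetric distribution\<close>

text \<open>Pushing a density \<open>h (f x)\<close> forward along \<open>f\<close> gives the
  density \<open>D s * h s\<close>. Existence chooses \<open>h\<close> to make this the radial
  density; uniqueness cancels \<open>D\<close>.\<close>

lemma unique_symmetric_distribution:
  fixes f :: "real ^ 'n::finite \<Rightarrow> real" and r :: "real \<Rightarrow> real"
  assumes law: "power_law lborel f S (real n)" and n: "n \<ge> 2"
    and homogeneous: "\<forall>c\<ge>0. \<forall>x. f (c *\<^sub>R x) = c * f x"
    and r: "prob_density_pos r"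
  defines "\<rho> \<equiv> \<lambda>x. r (f x) / (f x ^ (n - 1) * S)"
  shows "lebesgue_density (density lborel (\<lambda>x. ennreal (\<rho> x))) \<rho>"
    and "symmetric_distribution f r (density lborel (\<lambda>x. ennreal (\<rho> x)))"
    and "\<And>\<mu>. symmetric_distribution f r \<mu> \<Longrightarrow> \<mu> = density lborel (\<lambda>x. ennreal (\<rho> x))"
proof -
  have f[measurable]: "f \<in> borel_measurable borel" and f_nonneg: "\<And>x. 0 \<le> f x" and S: "S > 0"
    and E: "\<And>c. emeasure lborel {x. f x \<le> c} = ennreal (S / real n * max 0 c powr real n)"
    using law by (auto simp: power_law_def)
  have r_nonneg: "\<And>s. s > 0 \<Longrightarrow> 0 \<le> r s"
    and r_int: "(\<integral>\<^sup>+s\<in>{0<..}. ennreal (r s) \<partial>lborel) = 1"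
    using r by (auto simp: prob_density_pos_def)
  \<comment> \<open>\<open>r\<close> is only known to be measurable on the positive half-line, so it
    is extended by 0.\<close>
  define q where "q s = indicator {0<..} s *\<^sub>R r s" for s
  have q[measurable]: "q \<in> borel_measurable borel"
    using r unfolding prob_density_pos_def q_def
    by (subst (asm) borel_measurable_restrict_space_iff) auto
  define w where "w s = q s / (s ^ (n - 1) * S)" for s
  have w[measurable]: "w \<in> borel_measurable borel"
    unfolding w_def by measurable
  \<comment> \<open>Where \<open>f x = 0\<close> both sides are 0: as \<open>n\<close> is at least
    2, the denominator vanishes, and division by 0 yields 0.\<close>
  have \<rho>: "\<rho> = (\<lambda>x. w (f x))"
  proof
    fix x
    show "\<rho> x = w (f x)"
      using f_nonneg[of x] n by (cases "f x = 0") (auto simp: \<rho>_def w_def q_def)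
  qed
  have \<rho>_nonneg: "0 \<le> \<rho> x" for x
    using S r_nonneg f_nonneg[of x] unfolding \<rho> w_def q_def by (auto simp: indicator_def)
  show dens: "lebesgue_density (density lborel (\<lambda>x. ennreal (\<rho> x))) \<rho>"
    using \<rho>_nonneg unfolding lebesgue_density_def \<rho> by auto
  define D where "D s = ennreal (S * s powr (real n - 1)) * indicator {0<..} s" for s
  have D[measurable]: "D \<in> borel_measurable borel"
    unfolding D_def by measurable
  have distr_f: "distr lborel borel f = density lborel D"
    using power_law_distr[OF law] by (simp add: D_def[abs_def])
  define R where "R s = ennreal (r s) * indicator {0<..} s" for s
  have R_q: "R s = ennreal (q s)" for s
    by (simp add: R_def q_def indicator_def)
  have R[measurable]: "R \<in> borel_measurable borel"
    unfolding R_q[abs_def] by measurable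
  have distr_radial: "distr (density lborel (\<lambda>x. h (f x))) lborel f = density lborel (\<lambda>s. D s * h s)"
    if [measurable]: "h \<in> borel_measurable borel" for h :: "real \<Rightarrow> ennreal"
  proof -
    have "distr (density lborel (\<lambda>x. h (f x))) lborel f = distr (density lborel (\<lambda>x. h (f x))) borel f"
      by (rule distr_cong) auto
    also have "\<dots> = density (distr lborel borel f) h"
      by (rule density_distr[symmetric]) auto
    also have "\<dots> = density lborel (\<lambda>s. D s * h s)"
      unfolding distr_f by (rule density_density_eq) auto
    finally show ?thesis .
  qed
  have D_w: "D s * ennreal (w s) = R s" for s
    using S r_nonneg[of s] n powr_realpow[of s "n - 1"]
    by (auto simp: D_def w_def R_def q_def indicator_def of_nat_diff ennreal_mult'[symmetric])
  let ?\<mu> = "density lborel (\<lambda>x. ennreal (\<rho> x))"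
  have distr_\<mu>: "distr ?\<mu> lborel f = density lborel R"
    unfolding \<rho> using distr_radial[of "\<lambda>s. ennreal (w s)"] by (simp add: D_w)
  have "prob_space (density lborel R)"
    using r_int by (intro prob_spaceI) (simp add: emeasure_density R_def)
  \<comment> \<open>Pushing forward preserves total mass, so it is enough that the radial law has
    mass 1.\<close>
  then have "prob_space ?\<mu>"
    using prob_space_distrD[of f ?\<mu> lborel] distr_\<mu> by simp
  then show "symmetric_distribution f r ?\<mu>"
    using dens distr_\<mu> R unfolding symmetric_distribution_def symmetric_wrt_def radial_density_def
      distributed_def R_def[abs_def] \<rho> by (auto intro!: exI[of _ w])
  \<comment> \<open>If \<open>f\<close> were nowhere positive, its sublevel sets at 0 and 1 would
    coincide, yet their measures are 0 and \<open>S / real n\<close>. A point with positive value is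
    then rescaled to level 1.\<close>
  obtain x0 where x0: "f x0 = 1"
  proof -
    have "\<not> (\<forall>x. f x \<le> 0)"
    proof
      assume "\<forall>x. f x \<le> 0"
      then have "{x. f x \<le> 0} = {x. f x \<le> 1}"
        by (intro Collect_cong) (auto intro: order_trans[OF _ zero_le_one])
      then show False using E[of 0] E[of 1] S n by simp
    qed
    then obtain x where "f x > 0" by (auto simp: not_le)
    then have "f ((1 / f x) *\<^sub>R x) = 1" by (simp add: homogeneous)
    then show ?thesis by (rule that)
  qed
  fix \<mu> assume "symmetric_distribution f r \<mu>"
  then obtain g where g: "lebesgue_density \<mu> (\<lambda>x. g (f x))" and radial: "radial_density f \<mu> r"
    unfolding symmetric_distribution_def symmetric_wrt_def by (elim conjE exE)
  \<comment> \<open>Only \<open>g \<circ> f\<close> is known to be measurable, so \<open>g\<close> is read off along a ray.\<close>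
  define g' where "g' s = g (f (s *\<^sub>R x0))" for s
  have g'[measurable]: "g' \<in> borel_measurable borel"
  proof -
    have "(\<lambda>x. g (f x)) \<in> borel_measurable borel"
      using g by (simp add: lebesgue_density_def)
    moreover have "(\<lambda>s. s *\<^sub>R x0) \<in> borel \<rightarrow>\<^sub>M borel"
      by measurable
    ultimately show ?thesis
      unfolding g'_def[abs_def] by (rule measurable_compose[rotated])
  qed
  \<comment> \<open>By homogeneity the point \<open>f x *\<^sub>R x0\<close> of the ray has the same
    level as \<open>x\<close>.\<close>
  have g'_f: "g' (f x) = g (f x)" for x
    using homogeneous x0 f_nonneg[of x] by (simp add: g'_def)
  have \<mu>: "\<mu> = density lborel (\<lambda>x. ennreal (g' (f x)))"
    using g by (simp add: g'_f lebesgue_density_def)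
  have "density lborel (\<lambda>s. D s * ennreal (g' s)) = density lborel R"
    using radial distr_radial[of "\<lambda>s. ennreal (g' s)"]
    unfolding \<mu> radial_density_def distributed_def R_def[abs_def] by simp
  then have "AE s in lborel. D s * ennreal (g' s) = D s * ennreal (w s)"
    unfolding D_w by (intro sigma_finite_measure.density_unique[OF sigma_finite_lborel]) auto
  \<comment> \<open>\<open>D\<close> is finite, so it cancels wherever it is positive.\<close>
  then have "AE s in lborel. 0 < D s \<longrightarrow> ennreal (g' s) = ennreal (w s)"
    by eventually_elim (auto simp: D_def ennreal_mult_cancel_left indicator_def split: if_splits)
  \<comment> \<open>Since \<open>D\<close> is the density of the image of Lebesgue measure under
    \<open>f\<close>, the points with \<open>D s = 0\<close> are negligible for that image, and the
    equality pulls back along \<open>f\<close>.\<close>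
  then have "AE s in distr lborel borel f. ennreal (g' s) = ennreal (w s)"
    unfolding distr_f by (subst AE_density) auto
  then have "AE x in lborel. ennreal (g' (f x)) = ennreal (w (f x))"
    by (subst (asm) AE_distr_iff) auto
  then show "\<mu> = ?\<mu>"
    unfolding \<mu> \<rho> by (intro density_cong) auto
qed

section \<open>The density formula\<close>

theorem corollary1:
  fixes t :: "'n::finite lp_tree"
    and f :: "real ^ 'n \<Rightarrow> real"
    and \<phi> :: "real \<Rightarrow> real"
    and n :: nat
  assumes "lp_nested_tree t"
    and "f = lp_nested t"
    and "n = CARD('n)"
    and "n \<ge> 2"
    and "prob_density_pos \<phi>"
  shows "(\<exists>!\<mu>. symmetric_distribution f \<phi> \<mu>)
    \<and> (\<forall>\<mu>. symmetric_distribution f \<phi> \<mu> \<longrightarrow>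
          lebesgue_density \<mu> (\<lambda>x. \<phi> (f x) / (f x ^ (n - 1) * surface f 1)))
    \<and> (\<forall>x. \<phi> (f x) / (f x ^ (n - 1) * surface f 1) =
          \<phi> (f x) / (2 ^ n * f x ^ (n - 1)) *
          (\<Prod>I\<in>inner_nodes t.
             node_exponent t I ^ (num_children t I - 1) *
             (\<Prod>k = 1..num_children t I - 1.
                inverse (Beta (real (\<Sum>i = 1..k. num_leaves t (I @ [i])) / node_exponent t I)
                              (real (num_leaves t (I @ [k + 1])) / node_exponent t I)))))"
proof -
  define S where "S = 2 ^ n / (\<Prod>I\<in>inner_nodes t. node_factor t I)"
  have law: "power_law lborel f S (real n)"
    using power_law_lp_nested[OF assms(1)] assms(2,3) by (simp add: S_def)
  have surface: "surface f 1 = S"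
    by (rule surface_power_law[OF law])
  have "\<forall>c\<ge>0. \<forall>x. f (c *\<^sub>R x) = c * f x"
    using assms(1) unfolding assms(2) lp_nested_tree_def by (auto intro: lp_nested_scaleR)
  note * = unique_symmetric_distribution[OF law assms(4) this assms(5)]
  have "\<exists>!\<mu>. symmetric_distribution f \<phi> \<mu>"
    using *(2,3) by blast
  moreover have "lebesgue_density \<mu> (\<lambda>x. \<phi> (f x) / (f x ^ (n - 1) * surface f 1))"
    if "symmetric_distribution f \<phi> \<mu>" for \<mu>
    unfolding surface *(3)[OF that] by (rule *(1))
  moreover have "\<phi> (f x) / (f x ^ (n - 1) * surface f 1) =
      \<phi> (f x) / (2 ^ n * f x ^ (n - 1)) * (\<Prod>I\<in>inner_nodes t. node_factor t I)" for x
    unfolding surface S_def by (simp add: mult.commute)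
  ultimately show ?thesis
    unfolding node_factor_def by blast
qed

end
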